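(* Let $T$ be a finite nonempty set of integers, all $>1$, and $M=\max_{t\in T}(t-1)$. Let $B$ be the $2^M\times2^M$ signed de Bruijn matrix and $\mathcal R(f)$ the rules matrix attached to $T$ (defined in the context). Then the rules matrix $\mathcal R(f)$ is nonsingular; moreover it is similar to the block diagonal matrix $$\begin{pmatrix}B^T&0\\0&2\end{pmatrix},$$ and $\mathcal R(f)$ is diagonalizable over $\mathbb C$.
   Context: For $a=(a_0,\dots,a_{M-1})\in\mathbb F_2^M$ and $\varepsilon\in\mathbb F_2$ put $\sigma_\varepsilon(a)=(a_1,\dots,a_{M-1},\varepsilon)$. $B$ is the matrix indexed by $\mathbb F_2^M$ with $B_{a,b}=(-1)^{\varepsilon\sum_{t\in T}a_{M-t+1}}$ if $b=\sigma_\varepsilon(a)$, $\varepsilon\in\mathbb F_2$, and $B_{a,b}=0$ otherwise. Definition of the rules matrix. Let $\mathcal S=\prod_{t\in T}\mathbb F_2^{t-1}$. Write $u\in\mathcal S$ as $u=(u^{(t)})_{t\in T}$ with $u^{(t)}=(u^{(t)}_0,\dots,u^{(t)}_{t-2})$. For $\varepsilon\in\mathbb F_2$ define $\Sigma_\varepsilon(u)\in\mathcal S$ by $\Sigma_\varepsilon(u)^{(t)}=(u^{(t)}_1,\dots,u^{(t)}_{t-2},\varepsilon)$ for each $t\in T$. Let $W$ be the matrix with rows and columns indexed by $\mathcal S$ (rows are new states, columns are old states) with $W_{\Sigma_\varepsilon(u),u}=(-1)^{\varepsilon\sum_{t\in T}u^{(t)}_0}$ for $\varepsilon\in\mathbb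 F_2$, $u\in\mathcal S$, and all other entries zero. The expanded rules matrix is obtained from $W$ by adjoining one final row and one final column: the final column is zero except for its last entry (in the final row), which is $2$; the final row has, in the column indexed by $u\in\mathcal S$, the entry $1$ if $\sum_{t\in T}u^{(t)}_0=1$ in $\mathbb F_2$ and $0$ otherwise. The rules matrix $\mathcal R(f)$ is obtained from the expanded rules matrix by repeatedly deleting a zero row together with the column of the same index, until no zero row remains. It is well defined up to a simultaneous permutation of rows and columns. *)

theory Defs
  imports "Jordan_Normal_Form.Matrix" "HOL-Library.Z2" "HOL-Library.FuncSet"
begin

text \<open>The field of two elements is \<^typ>\<open>bit\<close>; vectors over it are lists of fixed length.\<close>

definition words :: "nat \<Rightarrow> bit list set" where
  "words n = {a. length a = n}"

definition shift :: "bit \<Rightarrow> bit list \<Rightarrow> bit list" where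
  "shift \<epsilon> a = tl a @ [\<epsilon>]"

definition sgn_bit :: "bit \<Rightarrow> 'a::ring_1" where
  "sgn_bit b = (-1) ^ (of_bit b :: nat)"

text \<open>
  A matrix with rows and columns indexed by a finite set is a function of two indices; listing
  the index set without repetition turns it into a matrix with numbered rows and columns.
\<close>

definition indexed_mat :: "'i list \<Rightarrow> ('i \<Rightarrow> 'i \<Rightarrow> 'a) \<Rightarrow> 'a mat" where
  "indexed_mat xs A = mat (length xs) (length xs) (\<lambda>(i, j). A (xs ! i) (xs ! j))"

definition mat_indexed_by :: "'i set \<Rightarrow> ('i \<Rightarrow> 'i \<Rightarrow> 'a) \<Rightarrow> 'a mat \<Rightarrow> bool" where
  "mat_indexed_by I A N \<longleftrightarrow> (\<exists>xs. distinct xs \<and> set xs = I \<and> N = indexed_mat xs A)"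

definition diagonalizable :: "'a::semiring_1 mat \<Rightarrow> bool" where
  "diagonalizable A \<longleftrightarrow> (\<exists>D. diagonal_mat D \<and> similar_mat A D)"


section \<open>The signed de Bruijn matrix\<close>

definition max_shift :: "nat set \<Rightarrow> nat" where
  "max_shift T = Max ((\<lambda>t. t - 1) ` T)"

text \<open>
  The two shifts of a word of positive length differ, so at most one summand below is nonzero.
  The index \<open>M - t + 1\<close> is written \<open>M + 1 - t\<close> because subtraction on
  \<^typ>\<open>nat\<close> truncates and \<open>t = M + 1\<close> occurs.
\<close>

definition de_bruijn_entry :: "nat set \<Rightarrow> bit list \<Rightarrow> bit list \<Rightarrow> 'a::ring_1" where
  "de_bruijn_entry T a b =
     (\<Sum>\<epsilon>\<in>{0, 1}. if b = shift \<epsilon> a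
                then sgn_bit (\<epsilon> * (\<Sum>t\<in>T. a ! (max_shift T + 1 - t))) else 0)"

definition signed_de_bruijn_matrix :: "nat set \<Rightarrow> 'a::ring_1 mat \<Rightarrow> bool" where
  "signed_de_bruijn_matrix T B \<longleftrightarrow>
     mat_indexed_by (words (max_shift T)) (de_bruijn_entry T) B"


section \<open>The rules matrix\<close>

type_synonym state = "nat \<Rightarrow> bit list"

definition states :: "nat set \<Rightarrow> state set" where
  "states T = (\<Pi>\<^sub>E t\<in>T. words (t - 1))"

definition state_shift :: "nat set \<Rightarrow> bit \<Rightarrow> state \<Rightarrow> state" where
  "state_shift T \<epsilon> u = (\<lambda>t\<in>T. shift \<epsilon> (u t))"

text \<open>The first argument \<open>v\<close> is the row (new state), the second one \<open>u\<close> the column (old state).\<close>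

definition W_entry :: "nat set \<Rightarrow> state \<Rightarrow> state \<Rightarrow> 'a::ring_1" where
  "W_entry T v u =
     (\<Sum>\<epsilon>\<in>{0, 1}. if v = state_shift T \<epsilon> u
                then sgn_bit (\<epsilon> * (\<Sum>t\<in>T. u t ! 0)) else 0)"

text \<open>The index \<^term>\<open>None\<close> is that of the adjoined final row and column.\<close>

definition expanded_indices :: "nat set \<Rightarrow> state option set" where
  "expanded_indices T = insert None (Some ` states T)"

fun expanded_entry :: "nat set \<Rightarrow> state option \<Rightarrow> state option \<Rightarrow> 'a::ring_1" where
  "expanded_entry T (Some v) (Some u) = W_entry T v u"
| "expanded_entry T (Some v) None = 0"
| "expanded_entry T None (Some u) = (if (\<Sum>t\<in>T. u t ! 0) = 1 then 1 else 0)"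
| "expanded_entry T None None = 2"

definition zero_row :: "('i \<Rightarrow> 'i \<Rightarrow> 'a::zero) \<Rightarrow> 'i set \<Rightarrow> 'i \<Rightarrow> bool" where
  "zero_row A I i \<longleftrightarrow> i \<in> I \<and> (\<forall>j\<in>I. A i j = 0)"

definition delete_zero_row :: "('i \<Rightarrow> 'i \<Rightarrow> 'a::zero) \<Rightarrow> 'i set \<Rightarrow> 'i set \<Rightarrow> bool" where
  "delete_zero_row A I J \<longleftrightarrow> (\<exists>i. zero_row A I i \<and> J = I - {i})"

text \<open>
  The order of the deletions and the numbering of the remaining indices are left open, so a
  statement about all \<open>R\<close> satisfying the following predicate covers every choice.
\<close>

definition rules_matrix :: "nat set \<Rightarrow> 'a::ring_1 mat \<Rightarrow> bool" where
  "rules_matrix T R \<longleftrightarrow>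
     (\<exists>K. (delete_zero_row (expanded_entry T :: _ \<Rightarrow> _ \<Rightarrow> 'a))\<^sup>*\<^sup>* (expanded_indices T) K \<and>
          (\<forall>i. \<not> zero_row (expanded_entry T :: _ \<Rightarrow> _ \<Rightarrow> 'a) K i) \<and>
          mat_indexed_by K (expanded_entry T) R)"


section \<open>Existence\<close>

lemma mat_indexed_by_exists: "finite I \<Longrightarrow> \<exists>N. mat_indexed_by I A N"
  unfolding mat_indexed_by_def using finite_distinct_list by metis

lemma finite_words: "finite (words n)"
proof -
  have "(UNIV :: bit set) = {0, 1}"
    using bit_not_zero_iff by blast
  then have "finite (UNIV :: bit set)"
    by (metis finite.emptyI finite.insertI)
  then show ?thesis
    using finite_lists_length_eq[of "UNIV :: bit set" n] by (simp add: words_def)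
qed

lemma delete_zero_rows_exists:
  "finite I \<Longrightarrow> \<exists>K. (delete_zero_row A)\<^sup>*\<^sup>* I K \<and> finite K \<and> (\<forall>i. \<not> zero_row A K i)"
proof (induction "card I" arbitrary: I rule: less_induct)
  case less
  show ?case
  proof (cases "\<exists>i. zero_row A I i")
    case False
    then show ?thesis using less.prems by blast
  next
    case True
    then obtain i where i: "zero_row A I i" by blast
    then have "i \<in> I" by (simp add: zero_row_def)
    then have "card (I - {i}) < card I"
      using less.prems by (meson card_Diff1_less)
    then obtain K where K: "(delete_zero_row A)\<^sup>*\<^sup>* (I - {i}) K" "finite K" "\<forall>i. \<not> zero_row A K i"
      using less.hyps[of "I - {i}"] less.prems by auto
    have "delete_zero_row A I (I - {i})"
      using i by (auto simp: delete_zero_row_def)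
    then show ?thesis
      using K by (meson converse_rtranclp_into_rtranclp)
  qed
qed

lemma signed_de_bruijn_matrix_exists: "\<exists>B :: 'a::ring_1 mat. signed_de_bruijn_matrix T B"
  unfolding signed_de_bruijn_matrix_def using mat_indexed_by_exists finite_words by blast

lemma rules_matrix_exists:
  assumes "finite T"
  shows "\<exists>R :: 'a::ring_1 mat. rules_matrix T R"
proof -
  have "finite (expanded_indices T)"
    using assms by (simp add: expanded_indices_def states_def finite_PiE finite_words)
  from delete_zero_rows_exists[OF this, of "expanded_entry T :: _ \<Rightarrow> _ \<Rightarrow> 'a"]
  show ?thesis
    unfolding rules_matrix_def using mat_indexed_by_exists by meson
qed

end

(*
  Cutting a word of length M down to its last t - 1 letters for each t in T embeds the words into
  the states and intertwines the shifts; a state survives the deletion of zero rows iff it has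
  predecessors of every order, that is, iff M successive shifts have overwritten it by a word.  So
  R(f) is, up to a permutation, the block matrix with blocks B^T, 0, c, 2.  Since max T is in T, the
  exponent of -1 in row a of B contains a_0, which makes the rows of 0a' and 1a' orthogonal, so
  B B^T = 2.  Hence B^T multiplies scalar products by 2: it does not have the eigenvalue 2, so that
  c can be cleared, and it has no Jordan block of size 2, because the images of two vectors v, w with
  B^T v = d v and B^T w = d w + v would have the wrong scalar product.
*)

theory Submission
  imports Defs "Jordan_Normal_Form.Jordan_Normal_Form_Existence"
begin

section \<open>Similarity and diagonalizability\<close>

lemma sum_nth_distinct:
  assumes "distinct xs"
  shows "(\<Sum>k = 0..<length xs. f (xs ! k)) = (\<Sum>x\<in>set xs. f x)"
  using sum.reindex_bij_betw[OF bij_betw_nth[OF assms refl refl], of f]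
  by (simp add: atLeast0LessThan)

text \<open>The matrices \<open>P\<close> and \<open>Q\<close> are the mutually inverse permutation
  matrices that translate one enumeration into the other. This absorbs the free choice of numbering
  in \<open>rules_matrix\<close>.\<close>

lemma similar_indexed_mat:
  fixes A :: "'i \<Rightarrow> 'i \<Rightarrow> 'a::comm_ring_1"
  assumes "distinct xs" "distinct ys" "set xs = set ys"
  shows "similar_mat (indexed_mat xs A) (indexed_mat ys A)"
proof -
  let ?n = "length xs"
  have len: "length ys = ?n"
    using assms by (metis distinct_card)
  define P :: "'a mat" where "P = mat ?n ?n (\<lambda>(i, j). of_bool (xs ! i = ys ! j))"
  define Q :: "'a mat" where "Q = mat ?n ?n (\<lambda>(i, j). of_bool (ys ! i = xs ! j))"
  have sum_xs: "(\<Sum>k = 0..<?n. f (xs ! k)) = (\<Sum>x\<in>set xs. f x)" for f :: "'i \<Rightarrow> 'a"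
    using assms by (intro sum_nth_distinct)
  have sum_ys: "(\<Sum>k = 0..<?n. f (ys ! k)) = (\<Sum>x\<in>set xs. f x)" for f :: "'i \<Rightarrow> 'a"
    using assms sum_nth_distinct[of ys f] len by simp
  have in_xs: "xs ! i \<in> set xs" "ys ! i \<in> set xs" if "i < ?n" for i
    using that len nth_mem[of i xs] nth_mem[of i ys] unfolding assms(3) by simp_all
  have xs_eq: "xs ! i = xs ! j \<longleftrightarrow> i = j" "ys ! i = ys ! j \<longleftrightarrow> i = j" if "i < ?n" "j < ?n" for i j
    using that len nth_eq_iff_index_eq[OF assms(1)] nth_eq_iff_index_eq[OF assms(2)] by simp_all
  have delta: "(\<Sum>x\<in>set xs. of_bool (y = x) * f x) = f y"
    "(\<Sum>x\<in>set xs. f x * of_bool (x = y)) = f y" if "y \<in> set xs" for y and f :: "'i \<Rightarrow> 'a"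
    using that by (simp_all add: of_bool_def if_distrib[of "\<lambda>c. c * _"] if_distrib[of "(*) _"]
        sum.delta sum.delta' cong: if_cong)
  show ?thesis
  proof (rule similar_matI)
    show "{indexed_mat xs A, indexed_mat ys A, P, Q} \<subseteq> carrier_mat ?n ?n"
      by (auto simp: indexed_mat_def P_def Q_def len)
    have "(P * Q) $$ (i, j) = of_bool (i = j)" if "i < ?n" "j < ?n" for i j
    proof -
      have "(P * Q) $$ (i, j) = (\<Sum>k = 0..<?n. of_bool (xs ! i = ys ! k) * of_bool (ys ! k = xs ! j))"
        using that by (simp add: P_def Q_def scalar_prod_def)
      also have "\<dots> = of_bool (xs ! i = xs ! j)"
        by (subst sum_ys[where f = "\<lambda>y. of_bool (xs ! i = y) * of_bool (y = xs ! j)"])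
          (rule delta(1)[OF in_xs(1)[OF that(1)]])
      finally show ?thesis using that by (simp only: xs_eq(1))
    qed
    then show "P * Q = 1\<^sub>m ?n"
      by (intro eq_matI) (simp_all add: P_def Q_def)
    have "(Q * P) $$ (i, j) = of_bool (i = j)" if "i < ?n" "j < ?n" for i j
    proof -
      have "(Q * P) $$ (i, j) = (\<Sum>k = 0..<?n. of_bool (ys ! i = xs ! k) * of_bool (xs ! k = ys ! j))"
        using that by (simp add: P_def Q_def scalar_prod_def)
      also have "\<dots> = of_bool (ys ! i = ys ! j)"
        by (subst sum_xs[where f = "\<lambda>x. of_bool (ys ! i = x) * of_bool (x = ys ! j)"])
          (rule delta(1)[OF in_xs(2)[OF that(1)]])
      finally show ?thesis using that by (simp only: xs_eq(2))
    qed
    then show "Q * P = 1\<^sub>m ?n"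
      by (intro eq_matI) (simp_all add: P_def Q_def)
    have PA: "(P * indexed_mat ys A) $$ (i, j) = A (xs ! i) (ys ! j)" if "i < ?n" "j < ?n" for i j
    proof -
      have "(P * indexed_mat ys A) $$ (i, j)
          = (\<Sum>k = 0..<?n. of_bool (xs ! i = ys ! k) * A (ys ! k) (ys ! j))"
        using that by (simp add: P_def indexed_mat_def scalar_prod_def len)
      also have "\<dots> = A (xs ! i) (ys ! j)"
        by (subst sum_ys[where f = "\<lambda>y. of_bool (xs ! i = y) * A y (ys ! j)"])
          (rule delta(1)[OF in_xs(1)[OF that(1)]])
      finally show ?thesis .
    qed
    have "(P * indexed_mat ys A * Q) $$ (i, j) = A (xs ! i) (xs ! j)" if "i < ?n" "j < ?n" for i j
    proof -
      have "(P * indexed_mat ys A * Q) $$ (i, j)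
          = (\<Sum>k = 0..<?n. (P * indexed_mat ys A) $$ (i, k) * Q $$ (k, j))"
        using that by (simp add: P_def Q_def indexed_mat_def scalar_prod_def len)
      also have "\<dots> = (\<Sum>k = 0..<?n. A (xs ! i) (ys ! k) * of_bool (ys ! k = xs ! j))"
        using that by (intro sum.cong refl) (simp only: PA atLeastLessThan_iff, simp add: Q_def)
      also have "\<dots> = A (xs ! i) (xs ! j)"
        by (subst sum_ys[where f = "\<lambda>y. A (xs ! i) y * of_bool (y = xs ! j)"])
          (rule delta(2)[OF in_xs(1)[OF that(2)]])
      finally show ?thesis .
    qed
    then show "indexed_mat xs A = P * indexed_mat ys A * Q"
      by (intro eq_matI) (simp_all add: indexed_mat_def P_def Q_def)
  qed
qed

lemma det_nonzero_obtains_inverse: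
  fixes A :: "'a::field mat"
  assumes "A \<in> carrier_mat n n" "det A \<noteq> 0"
  obtains B where "B \<in> carrier_mat n n" "A * B = 1\<^sub>m n" "B * A = 1\<^sub>m n"
proof -
  have "A \<in> Units (ring_mat TYPE('a) n ())"
    using assms by (rule det_non_zero_imp_unit)
  then show thesis
    using that unfolding Units_def ring_mat_def by auto
qed

lemma invertible_mat_det_nonzero:
  fixes A :: "'a::field mat"
  assumes "A \<in> carrier_mat n n" "det A \<noteq> 0"
  shows "invertible_mat A"
proof -
  obtain B where "B \<in> carrier_mat n n" "A * B = 1\<^sub>m n" "B * A = 1\<^sub>m n"
    using assms by (rule det_nonzero_obtains_inverse)
  then have "inverts_mat A B" "inverts_mat B A"
    using assms(1) by (simp_all add: inverts_mat_def)
  then show ?thesis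
    using assms(1) by (auto simp: invertible_mat_def)
qed

text \<open>Conjugating the block diagonal matrix by the unipotent matrix with lower left block
  \<open>- Y\<close> creates the lower left block \<open>D * Y - Y * A\<close>. The Sylvester
  equation says that this is \<open>C\<close>, so solving it clears the corner.\<close>

lemma similar_mat_four_block_lower:
  fixes A :: "'a::comm_ring_1 mat"
  assumes A: "A \<in> carrier_mat n n" and D: "D \<in> carrier_mat m m"
    and C: "C \<in> carrier_mat m n" and Y: "Y \<in> carrier_mat m n"
    and sylvester: "Y * A + C = D * Y"
  shows "similar_mat (four_block_mat A (0\<^sub>m n m) C D) (four_block_mat A (0\<^sub>m n m) (0\<^sub>m m n) D)"
proof (rule similar_matI)
  let ?P = "four_block_mat (1\<^sub>m n) (0\<^sub>m n m) (- Y) (1\<^sub>m m)"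
  let ?Q = "four_block_mat (1\<^sub>m n) (0\<^sub>m n m) Y (1\<^sub>m m)"
  let ?E = "four_block_mat A (0\<^sub>m n m) (0\<^sub>m m n) D"
  show "{four_block_mat A (0\<^sub>m n m) C D, ?E, ?P, ?Q} \<subseteq> carrier_mat (n + m) (n + m)"
    using A D by auto
  show "?P * ?Q = 1\<^sub>m (n + m)"
    by (subst mult_four_block_mat[where ?n1.0 = n and ?n2.0 = m]) (use Y in \<open>auto intro!: eq_matI\<close>)
  show "?Q * ?P = 1\<^sub>m (n + m)"
    by (subst mult_four_block_mat[where ?n1.0 = n and ?n2.0 = m]) (use Y in \<open>auto intro!: eq_matI\<close>)
  have PE: "?P * ?E = four_block_mat A (0\<^sub>m n m) (- Y * A) D"
    by (subst mult_four_block_mat[where ?n1.0 = n and ?n2.0 = m]) (use A D Y in auto)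
  have "C = - Y * A + D * Y"
    using A Y C by (intro eq_matI) (auto simp flip: sylvester)
  then show "four_block_mat A (0\<^sub>m n m) C D = ?P * ?E * ?Q"
    unfolding PE
    by (subst mult_four_block_mat[where ?n1.0 = n and ?n2.0 = m]) (use A D Y in auto)
qed

text \<open>Carries a similarity found over the rationals to the complex numbers, where
  diagonalizability is asked.\<close>

lemma (in semiring_hom) similar_mat_hom:
  assumes "similar_mat A B"
  shows "similar_mat (mat\<^sub>h A) (mat\<^sub>h B)"
proof -
  obtain n P Q where c: "{A, B, P, Q} \<subseteq> carrier_mat n n"
    and w: "P * Q = 1\<^sub>m n" "Q * P = 1\<^sub>m n" "A = P * B * Q"
    using similar_matD[OF assms] by blast
  show ?thesis
  proof (rule similar_matI)
    show "{mat\<^sub>h A, mat\<^sub>h B, mat\<^sub>h P, mat\<^sub>h Q} \<subseteq> carrier_mat n n"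
      using c by auto
    show "mat\<^sub>h P * mat\<^sub>h Q = 1\<^sub>m n" "mat\<^sub>h Q * mat\<^sub>h P = 1\<^sub>m n"
      using c w(1,2) mat_hom_mult[of P n n Q n] mat_hom_mult[of Q n n P n] by (auto simp: mat_hom_one)
    show "mat\<^sub>h A = mat\<^sub>h P * mat\<^sub>h B * mat\<^sub>h Q"
      using c mat_hom_mult[of P n n B n] mat_hom_mult[of "P * B" n n Q n] by (auto simp: w(3))
  qed
qed

section \<open>Diagonalizability through the Jordan normal form\<close>

lemma diagonalizable_similar:
  "similar_mat A B \<Longrightarrow> diagonalizable B \<Longrightarrow> diagonalizable A"
  unfolding diagonalizable_def using similar_mat_trans by blast

lemma diagonalizable_four_block:
  assumes "diagonalizable A" "diagonalizable D" "A \<in> carrier_mat n n" "D \<in> carrier_mat m m"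
  shows "diagonalizable (four_block_mat A (0\<^sub>m n m) (0\<^sub>m m n) D)"
proof -
  obtain A' D' where A': "diagonal_mat A'" "similar_mat A A'"
    and D': "diagonal_mat D'" "similar_mat D D'"
    using assms(1,2) by (auto simp: diagonalizable_def)
  have c: "A' \<in> carrier_mat n n" "D' \<in> carrier_mat m m"
    using similar_matD[OF A'(2)] similar_matD[OF D'(2)] assms(3,4) by auto
  have "diagonal_mat (four_block_mat A' (0\<^sub>m n m) (0\<^sub>m m n) D')"
    using A'(1) D'(1) c by (auto simp: diagonal_mat_def)
  then show ?thesis
    using similar_mat_four_block_0_0[OF A'(2) D'(2) assms(3,4)] by (auto simp: diagonalizable_def)
qed

text \<open>A nonzero entry off the diagonal must lie inside one Jordan block, where it is on the
  superdiagonal and where the diagonal is constant. The induction splits off the first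
  block.\<close>

lemma jordan_matrix_off_diagonal:
  assumes "i < sum_list (map fst n_as)" "j < sum_list (map fst n_as)"
    and "i \<noteq> j" "jordan_matrix n_as $$ (i, j) \<noteq> 0"
  shows "j = Suc i \<and> jordan_matrix n_as $$ (i, i) = jordan_matrix n_as $$ (j, j)"
  using assms
proof (induction n_as arbitrary: i j)
  case (Cons na n_as)
  obtain n a where na: "na = (n, a)" by fastforce
  show ?case
  proof (cases "i < n \<or> j < n")
    case True
    then show ?thesis
      using Cons.prems unfolding na jordan_matrix_Cons by (auto split: if_splits)
  next
    case False
    then have "i - n < sum_list (map fst n_as)" "j - n < sum_list (map fst n_as)" "i - n \<noteq> j - n"
      "jordan_matrix n_as $$ (i - n, j - n) \<noteq> 0"
      using Cons.prems unfolding na jordan_matrix_Cons by auto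
    from Cons.IH[OF this] show ?thesis
      using False Cons.prems(1,2) unfolding na jordan_matrix_Cons by auto
  qed
qed simp

lemma mult_mat_unit_vec:
  fixes A :: "'a::semiring_1 mat"
  assumes "A \<in> carrier_mat m n" "j < n"
  shows "A *\<^sub>v unit_vec n j = col A j"
  using assms by (intro eq_vecI) auto

text \<open>The matrix is a scalar multiple of a unitary one. The columns of \<open>P\<close> form a
  Jordan basis, and the Hermitian form rules out every chain of length 2 in it, so the Jordan form
  is already diagonal.\<close>

lemma diagonalizable_conformal:
  fixes A :: "complex mat"
  assumes A: "A \<in> carrier_mat n n" and "c \<noteq> 0"
    and conformal: "\<And>v w. v \<in> carrier_vec n \<Longrightarrow> w \<in> carrier_vec n \<Longrightarrow>
      (A *\<^sub>v v) \<bullet>c (A *\<^sub>v w) = c * (v \<bullet>c w)"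
  shows "diagonalizable A"
proof -
  obtain as where "char_poly A = (\<Prod>a\<leftarrow>as. [:- a, 1:])"
    using char_poly_factorized[OF A] by auto
  then obtain n_as where "jordan_nf A n_as"
    using jordan_nf_exists[OF A] by blast
  define J where "J = jordan_matrix n_as"
  have sim: "similar_mat A J"
    using \<open>jordan_nf A n_as\<close> by (simp add: jordan_nf_def J_def)
  then obtain P Q where wit: "similar_mat_wit A J P Q"
    by (auto simp: similar_mat_def)
  note w = similar_mat_witD2[OF A wit]
  have J: "J \<in> carrier_mat n n" and P: "P \<in> carrier_mat n n" and Q: "Q \<in> carrier_mat n n"
    using w(5-7) by auto
  have dim: "sum_list (map fst n_as) = n"
    using carrier_matD(1)[OF J] unfolding J_def jordan_matrix_dim .
  have "A * P = P * J * (Q * P)"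
    unfolding w(3) using J P Q by (intro assoc_mult_mat) auto
  then have AP: "A * P = P * J"
    using J P by (simp add: w(2))
  have A_col: "A *\<^sub>v col P j = P *\<^sub>v col J j" if "j < n" for j
    using that A J P by (metis AP col_mult2)
  have "col P j \<noteq> 0\<^sub>v n" if "j < n" for j
  proof
    assume "col P j = 0\<^sub>v n"
    then have "col (Q * P) j = 0\<^sub>v n"
      using that P Q by (auto simp del: w(2) intro!: eq_vecI)
    then have "col (1\<^sub>m n) j = (0\<^sub>v n :: complex vec)"
      by (simp only: w(2))
    then show False
      using that by simp
  qed
  then have norm_nz: "col P j \<bullet>c col P j \<noteq> 0" if "j < n" for j
    using that P by (metis col_dim carrier_matD(1) conjugate_square_eq_0_vec)
  \<comment> \<open>Strong induction on the column makes a failing column \<open>j\<close> the first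
    one, so that its predecessor belongs to a genuine eigenvector.\<close>
  have "\<forall>i<n. i \<noteq> j \<longrightarrow> J $$ (i, j) = 0" if "j < n" for j
    using that
  proof (induction j rule: less_induct)
    case (less j)
    show ?case
    proof (rule ccontr)
      assume "\<not> ?thesis"
      then obtain i where i: "i < n" "i \<noteq> j" "J $$ (i, j) \<noteq> 0"
        by blast
      have off: "j' = Suc i' \<and> J $$ (i', i') = J $$ (j', j')"
        if "i' < n" "j' < n" "i' \<noteq> j'" "J $$ (i', j') \<noteq> 0" for i' j'
        using jordan_matrix_off_diagonal[of i' n_as j'] that by (simp add: dim J_def)
      have j: "j = Suc i" and eq: "J $$ (i, i) = J $$ (j, j)"
        using off[OF i(1) less.prems i(2,3)] by auto
      define d s x y where "d = J $$ (i, i)" and "s = J $$ (i, j)"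
        and "x = col P i" and "y = col P j"
      have x: "x \<in> carrier_vec n" and y: "y \<in> carrier_vec n"
        using P i(1) less.prems by (auto simp: x_def y_def)
      \<comment> \<open>The induction hypothesis applies because \<open>i\<close> is the column just
        before \<open>j\<close>.\<close>
      have "col J i = d \<cdot>\<^sub>v unit_vec n i"
        using less.IH[of i] J i(1) j by (intro eq_vecI) (auto simp: d_def)
      then have Ax: "A *\<^sub>v x = d \<cdot>\<^sub>v x"
        using A_col[OF i(1)] P i(1) by (simp add: x_def mult_mat_vec mult_mat_unit_vec)
      have "col J j = d \<cdot>\<^sub>v unit_vec n j + s \<cdot>\<^sub>v unit_vec n i"
      proof (rule eq_vecI)
        fix k assume "k < dim_vec (d \<cdot>\<^sub>v unit_vec n j + s \<cdot>\<^sub>v unit_vec n i)"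
        then show "col J j $ k = (d \<cdot>\<^sub>v unit_vec n j + s \<cdot>\<^sub>v unit_vec n i) $ k"
          using off[of k j] J i(1,2) less.prems eq j
          by (cases "J $$ (k, j) = 0") (auto simp: d_def s_def)
      qed (use J in auto)
      then have Ay: "A *\<^sub>v y = d \<cdot>\<^sub>v y + s \<cdot>\<^sub>v x"
        using A_col[OF less.prems] P i(1) less.prems
        by (simp add: x_def y_def mult_add_distrib_mat_vec mult_mat_vec mult_mat_unit_vec)
      have "d * cnj d * (x \<bullet>c x) = c * (x \<bullet>c x)"
        using conformal[OF x x] x by (simp add: Ax conjugate_smult_vec ac_simps)
      then have d: "d * cnj d = c"
        using norm_nz[OF i(1)] unfolding x_def by simp
      \<comment> \<open>Since \<open>d * cnj d = c\<close>, the terms in the product of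
        \<open>x\<close> and \<open>y\<close> cancel. The remaining term is a product of nonzero
        factors: \<open>d\<close> is nonzero because \<open>c\<close> is, \<open>s\<close> by choice
        of \<open>i\<close>, and \<open>x\<close> is a column of an invertible matrix.\<close>
      have "c * (x \<bullet>c y) = d * cnj d * (x \<bullet>c y) + d * cnj s * (x \<bullet>c x)"
        using conformal[OF x y] x y
        by (simp add: Ax Ay conjugate_smult_vec conjugate_add_vec[of _ n]
            scalar_prod_add_distrib[of _ n] algebra_simps)
      then have "d * cnj s * (x \<bullet>c x) = 0"
        by (simp add: d)
      then show False
        using i(3) d \<open>c \<noteq> 0\<close> norm_nz[OF i(1)] by (auto simp: s_def x_def)
    qed
  qed
  then have "diagonal_mat J"
    using J by (auto simp: diagonal_mat_def)
  then show ?thesis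
    using sim by (auto simp: diagonalizable_def)
qed

section \<open>Matrices whose transpose is a multiple of the inverse\<close>

lemma scalar_mat_mult_vec:
  fixes v :: "'a::comm_ring_1 vec"
  assumes "v \<in> carrier_vec n"
  shows "(c \<cdot>\<^sub>m 1\<^sub>m n) *\<^sub>v v = c \<cdot>\<^sub>v v"
  using assms by (intro eq_vecI) (auto simp: scalar_prod_left_unit)

lemma scalar_prod_conformal:
  fixes A :: "'a::comm_ring_1 mat"
  assumes A: "A \<in> carrier_mat n n" and AA: "transpose_mat A * A = c \<cdot>\<^sub>m 1\<^sub>m n"
    and v: "v \<in> carrier_vec n" and w: "w \<in> carrier_vec n"
  shows "(A *\<^sub>v v) \<bullet> (A *\<^sub>v w) = c * (v \<bullet> w)"
proof -
  have "(A *\<^sub>v v) \<bullet> (A *\<^sub>v w) = (transpose_mat A *\<^sub>v (A *\<^sub>v v)) \<bullet> w"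
    using A v w by (subst transpose_vec_mult_scalar[of _ n n]) auto
  also have "transpose_mat A *\<^sub>v (A *\<^sub>v v) = (transpose_mat A * A) *\<^sub>v v"
    using A v by simp
  also have "\<dots> = c \<cdot>\<^sub>v v"
    using v by (simp add: AA scalar_mat_mult_vec[of _ n])
  finally show ?thesis
    using v w by simp
qed

lemma det_nonzero_conformal:
  fixes A :: "'a::field mat"
  assumes A: "A \<in> carrier_mat n n" and AA: "transpose_mat A * A = c \<cdot>\<^sub>m 1\<^sub>m n" and "c \<noteq> 0"
  shows "det A \<noteq> 0"
proof -
  have "det A * det A = c ^ n"
    using arg_cong[OF AA, of det] A by (simp add: det_mult[of _ n] det_transpose)
  with \<open>c \<noteq> 0\<close> show ?thesis
    by (metis mult_zero_left power_not_zero)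
qed

text \<open>An eigenvector \<open>v\<close> for \<open>e\<close> would satisfy
  \<open>e * e * (v \<bullet> v) = c * (v \<bullet> v)\<close>. Over the rationals
  \<open>v \<bullet> v\<close> vanishes only for \<open>v = 0\<close>, which forces
  \<open>e * e = c\<close>.\<close>

lemma no_eigenvalue_conformal:
  fixes A :: "rat mat"
  assumes A: "A \<in> carrier_mat n n" and AA: "transpose_mat A * A = c \<cdot>\<^sub>m 1\<^sub>m n" and "e * e \<noteq> c"
  shows "det (e \<cdot>\<^sub>m 1\<^sub>m n - A) \<noteq> 0"
proof
  assume "det (e \<cdot>\<^sub>m 1\<^sub>m n - A) = 0"
  moreover have "e \<cdot>\<^sub>m 1\<^sub>m n - A \<in> carrier_mat n n"
    using A by auto
  ultimately obtain v where v: "v \<in> carrier_vec n" "v \<noteq> 0\<^sub>v n" "(e \<cdot>\<^sub>m 1\<^sub>m n - A) *\<^sub>v v = 0\<^sub>v n"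
    using det_0_iff_vec_prod_zero_field by blast
  have "(e \<cdot>\<^sub>m 1\<^sub>m n - A) *\<^sub>v v = e \<cdot>\<^sub>v v - A *\<^sub>v v"
    using A v(1) by (subst minus_mult_distrib_mat_vec[of _ n n]) (auto simp: scalar_mat_mult_vec)
  then have diff: "e \<cdot>\<^sub>v v - A *\<^sub>v v = 0\<^sub>v n"
    using v(3) by simp
  have Av: "A *\<^sub>v v = e \<cdot>\<^sub>v v"
  proof (rule eq_vecI)
    fix i assume "i < dim_vec (e \<cdot>\<^sub>v v)"
    then show "(A *\<^sub>v v) $ i = (e \<cdot>\<^sub>v v) $ i"
      using arg_cong[OF diff, of "\<lambda>u. u $ i"] A v(1) by simp
  qed (use A v(1) in simp)
  have "e * e * (v \<bullet> v) = c * (v \<bullet> v)"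
    using scalar_prod_conformal[OF A AA v(1) v(1)] v(1) by (simp add: Av mult.assoc)
  then have "v \<bullet> v = 0"
    using \<open>e * e \<noteq> c\<close> by simp
  then show False
    using v(1,2) conjugate_square_eq_0_vec[OF v(1)] by simp
qed

text \<open>Conjugation fixes rational entries and so commutes with the matrix. Hence the bilinear
  identity for \<open>v\<close> and \<open>conjugate w\<close> is the Hermitian identity for
  \<open>v\<close> and \<open>w\<close>.\<close>

lemma diagonalizable_rat_conformal:
  fixes A :: "rat mat"
  assumes A: "A \<in> carrier_mat n n" and AA: "transpose_mat A * A = c \<cdot>\<^sub>m 1\<^sub>m n" and "c \<noteq> 0"
  shows "diagonalizable (map_mat of_rat A :: complex mat)"
proof (rule diagonalizable_conformal)
  let ?A = "map_mat of_rat A :: complex mat"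
  show cA: "?A \<in> carrier_mat n n"
    using A by simp
  show "of_rat c \<noteq> (0 :: complex)"
    using \<open>c \<noteq> 0\<close> by simp
  have "map_mat of_rat (transpose_mat A * A) = (of_rat c \<cdot>\<^sub>m 1\<^sub>m n :: complex mat)"
    unfolding AA by (rule eq_matI) auto
  then have AA': "transpose_mat ?A * ?A = of_rat c \<cdot>\<^sub>m 1\<^sub>m n"
    using A by (simp add: of_rat_hom.mat_hom_mult[of _ n n _ n] map_mat_transpose)
  have cnj: "cnj (of_rat q) = of_rat q" for q
    by (cases q) (simp add: of_rat_rat)
  fix v w :: "complex vec"
  assume v: "v \<in> carrier_vec n" and w: "w \<in> carrier_vec n"
  have "conjugate (?A *\<^sub>v w) = ?A *\<^sub>v conjugate w"
    using A w by (intro eq_vecI) (auto simp: scalar_prod_def cnj)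
  then show "(?A *\<^sub>v v) \<bullet>c (?A *\<^sub>v w) = of_rat c * (v \<bullet>c w)"
    using scalar_prod_conformal[OF cA AA' v, of "conjugate w"] w by simp
qed


section \<open>The signed de Bruijn matrix\<close>

lemma UNIV_bit: "(UNIV :: bit set) = {0, 1}"
  using bit_not_zero_iff by blast

lemma card_words: "card (words n) = 2 ^ n"
proof -
  have "finite (UNIV :: bit set)" "card (UNIV :: bit set) = 2"
    by (simp_all add: UNIV_bit)
  then show ?thesis
    using card_lists_length_eq[of "UNIV :: bit set" n] by (simp add: words_def)
qed

lemma shift_eq_iff: "shift \<epsilon> a = shift \<delta> b \<longleftrightarrow> tl a = tl b \<and> \<epsilon> = \<delta>"
  by (auto simp: shift_def)

lemma shift_in_words: "a \<in> words n \<Longrightarrow> 0 < n \<Longrightarrow> shift \<epsilon> a \<in> words n"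
  by (auto simp: shift_def words_def)

lemma length_enumeration_words:
  "distinct xs \<Longrightarrow> set xs = words n \<Longrightarrow> length xs = 2 ^ n"
  using distinct_card[of xs] by (simp add: card_words)

lemma signed_de_bruijn_carrier:
  assumes "signed_de_bruijn_matrix T B"
  shows "B \<in> carrier_mat (2 ^ max_shift T) (2 ^ max_shift T)"
  using assms
  by (auto simp: signed_de_bruijn_matrix_def mat_indexed_by_def indexed_mat_def
      length_enumeration_words)

lemma sgn_bit_simps [simp]: "sgn_bit 0 = 1" "sgn_bit 1 = -1"
  by (simp_all add: sgn_bit_def)

lemma sgn_bit_mult_self [simp]: "sgn_bit b * sgn_bit b = 1"
  by (cases b) simp_all

lemma sgn_bit_mult_complement: "b \<noteq> c \<Longrightarrow> sgn_bit b * sgn_bit c = -1"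
  by (cases b; cases c) simp_all

text \<open>In this form the overlap of two rows is visible: they share both nonzero columns if the
  words have the same tail, and none otherwise.\<close>

lemma de_bruijn_entry_shift:
  "de_bruijn_entry T a (shift \<epsilon> b) =
    (if tl a = tl b then sgn_bit (\<epsilon> * (\<Sum>t\<in>T. a ! (max_shift T + 1 - t))) else 0)"
  by (cases \<epsilon>) (auto simp: de_bruijn_entry_def shift_eq_iff)

context
  fixes T :: "nat set"
  assumes T: "finite T" "T \<noteq> {}" "\<forall>t\<in>T. 1 < t"
begin

section \<open>Orthogonality of the rows of the signed de Bruijn matrix\<close>

lemma max_shift_ge: "t \<in> T \<Longrightarrow> t - 1 \<le> max_shift T"
  using T(1) by (simp add: max_shift_def)

text \<open>This largest element of \<open>T\<close> is the one that brings the letter at index 0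
  into the sign exponent.\<close>

lemma Suc_max_shift_in: "Suc (max_shift T) \<in> T"
proof -
  have "max_shift T \<in> (\<lambda>t. t - 1) ` T"
    unfolding max_shift_def using T(1,2) by (intro Max_in) auto
  then obtain t where "t \<in> T" "max_shift T = t - 1"
    by blast
  then show ?thesis
    using T(3) by fastforce
qed

lemma max_shift_pos: "0 < max_shift T"
  using Suc_max_shift_in T(3) by fastforce

text \<open>The two words differ in their first letter only, and that letter enters the exponent
  exactly once, through \<open>t = Suc (max_shift T)\<close>.\<close>

lemma sign_exponent_neq:
  assumes a: "a \<in> words (max_shift T)" and b: "b \<in> words (max_shift T)"
    and tl: "tl a = tl b" and "a \<noteq> b"
  shows "(\<Sum>t\<in>T. a ! (max_shift T + 1 - t)) \<noteq> (\<Sum>t\<in>T. b ! (max_shift T + 1 - t))"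
proof -
  let ?M = "max_shift T"
  obtain x a' y b' where ab: "a = x # a'" "b = y # b'"
    using a b max_shift_pos by (cases a; cases b) (auto simp: words_def)
  \<comment> \<open>For every other \<open>t\<close> the index is positive, so it reads the common
    tail.\<close>
  have "a ! (?M + 1 - t) = b ! (?M + 1 - t)" if "t \<in> T - {Suc ?M}" for t
  proof -
    have "?M + 1 - t \<noteq> 0"
      using that max_shift_ge[of t] by auto
    then show ?thesis
      using tl ab by (simp add: nth_Cons')
  qed
  then have "(\<Sum>t\<in>T - {Suc ?M}. a ! (?M + 1 - t)) = (\<Sum>t\<in>T - {Suc ?M}. b ! (?M + 1 - t))"
    by (rule sum.cong[OF refl])
  moreover have "x \<noteq> y"
    using ab \<open>a \<noteq> b\<close> tl by simp
  moreover have "a ! (?M + 1 - Suc ?M) = x" "b ! (?M + 1 - Suc ?M) = y"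
    using ab by simp_all
  ultimately show ?thesis
    unfolding sum.remove[OF T(1) Suc_max_shift_in] by (simp only: add_right_cancel not_False_eq_True)
qed

text \<open>Rows with different tails have disjoint supports. For equal tails the shift by 0
  contributes 1 and the shift by 1 contributes the product of the two signs, which is 1 for equal
  words and -1 for distinct ones.\<close>

lemma de_bruijn_rows_orthogonal:
  assumes a: "a \<in> words (max_shift T)" and b: "b \<in> words (max_shift T)"
  shows "(\<Sum>c\<in>words (max_shift T). de_bruijn_entry T a c * de_bruijn_entry T b c)
    = (if a = b then 2 else 0 :: 'a::comm_ring_1)"
proof -
  let ?S = "\<lambda>a. \<Sum>t\<in>T. a ! (max_shift T + 1 - t)"
  let ?W = "words (max_shift T)"
  have "(\<Sum>c\<in>?W. de_bruijn_entry T a c * de_bruijn_entry T b c)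
      = (\<Sum>c\<in>?W. \<Sum>\<epsilon>\<in>{0, 1}. if c = shift \<epsilon> a
            then sgn_bit (\<epsilon> * ?S a) * (de_bruijn_entry T b c :: 'a) else 0)"
    unfolding de_bruijn_entry_def[of T a] sum_distrib_right by (intro sum.cong refl) simp
  also have "\<dots> = (\<Sum>\<epsilon>\<in>{0, 1}. \<Sum>c\<in>?W. if c = shift \<epsilon> a
            then sgn_bit (\<epsilon> * ?S a) * (de_bruijn_entry T b c :: 'a) else 0)"
    by (rule sum.swap)
  also have "\<dots> = (\<Sum>\<epsilon>\<in>{0, 1}. sgn_bit (\<epsilon> * ?S a) * (de_bruijn_entry T b (shift \<epsilon> a) :: 'a))"
    using a max_shift_pos by (intro sum.cong refl) (simp add: finite_words shift_in_words)
  also have "\<dots> = (if tl a = tl b then 1 + sgn_bit (?S a) * sgn_bit (?S b) else 0)"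
    unfolding de_bruijn_entry_shift by auto
  also have "\<dots> = (if a = b then 2 else 0)"
    using sign_exponent_neq[OF a b] by (auto simp: sgn_bit_mult_complement)
  finally show ?thesis .
qed

lemma signed_de_bruijn_mult_transpose:
  fixes B :: "'a::comm_ring_1 mat"
  assumes "signed_de_bruijn_matrix T B"
  shows "B * transpose_mat B = 2 \<cdot>\<^sub>m 1\<^sub>m (2 ^ max_shift T)"
proof -
  obtain xs where xs: "distinct xs" "set xs = words (max_shift T)"
    and B: "B = indexed_mat xs (de_bruijn_entry T)"
    using assms by (auto simp: signed_de_bruijn_matrix_def mat_indexed_by_def)
  have len: "length xs = 2 ^ max_shift T"
    using xs by (rule length_enumeration_words)
  show ?thesis
    unfolding len[symmetric]
  proof (rule eq_matI)
    fix i j assume "i < dim_row (2 \<cdot>\<^sub>m 1\<^sub>m (length xs) :: 'a mat)"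
      "j < dim_col (2 \<cdot>\<^sub>m 1\<^sub>m (length xs) :: 'a mat)"
    then have ij: "i < length xs" "j < length xs"
      by auto
    have "(B * transpose_mat B) $$ (i, j)
      = (\<Sum>k = 0..<length xs. de_bruijn_entry T (xs ! i) (xs ! k) * de_bruijn_entry T (xs ! j) (xs ! k))"
      using ij by (simp add: B indexed_mat_def scalar_prod_def)
    also have "\<dots> = (\<Sum>c\<in>words (max_shift T).
        de_bruijn_entry T (xs ! i) c * de_bruijn_entry T (xs ! j) c)"
      unfolding sum_nth_distinct[OF xs(1), of "\<lambda>c. de_bruijn_entry T (xs ! i) c * de_bruijn_entry T (xs ! j) c"]
        xs(2) ..
    also have "\<dots> = (if xs ! i = xs ! j then 2 else 0)"
      using nth_mem[OF ij(1)] nth_mem[OF ij(2)] unfolding xs(2)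
      by (rule de_bruijn_rows_orthogonal)
    finally show "(B * transpose_mat B) $$ (i, j) = (2 \<cdot>\<^sub>m 1\<^sub>m (length xs)) $$ (i, j)"
      using ij by (simp add: nth_eq_iff_index_eq[OF xs(1)])
  qed (simp_all add: B indexed_mat_def)
qed


section \<open>The rules matrix\<close>

text \<open>For a word \<open>a\<close> of length \<open>max_shift T\<close> this is the state
  reached from any initial state by shifting in the letters of \<open>a\<close>, since no component
  is longer than \<open>a\<close>.\<close>

definition word_state :: "bit list \<Rightarrow> state" where
  "word_state a = (\<lambda>t\<in>T. drop (max_shift T + 1 - t) a)"

lemma word_state_in_states:
  assumes "a \<in> words (max_shift T)"
  shows "word_state a \<in> states T"
proof -
  have "drop (max_shift T + 1 - t) a \<in> words (t - 1)" if "t \<in> T" for t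
    using that T(3) max_shift_ge[OF that] assms by (auto simp: words_def)
  then show ?thesis
    by (auto simp: word_state_def states_def)
qed

text \<open>The component at the largest \<open>t\<close> drops nothing and thus contains the whole
  word.\<close>

lemma inj_word_state: "inj word_state"
proof
  fix a b assume "word_state a = word_state b"
  then have "word_state a (Suc (max_shift T)) = word_state b (Suc (max_shift T))"
    by simp
  then show "a = b"
    using Suc_max_shift_in by (simp add: word_state_def)
qed

lemma state_shift_word_state:
  assumes "a \<in> words (max_shift T)"
  shows "state_shift T \<epsilon> (word_state a) = word_state (shift \<epsilon> a)"
proof -
  have "tl (drop (max_shift T + 1 - t) a) @ [\<epsilon>] = drop (max_shift T + 1 - t) (tl a @ [\<epsilon>])"
    if "t \<in> T" for t
  proof -
    \<comment> \<open>From \<open>t \<ge> 2\<close>: the drop stays within \<open>tl a\<close> and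
      never reaches the appended letter.\<close>
    have "max_shift T + 1 - t \<le> length (tl a)"
      using that assms T(3) by (auto simp: words_def)
    then show ?thesis
      by (simp add: tl_drop)
  qed
  then show ?thesis
    by (auto simp: state_shift_def word_state_def shift_def fun_eq_iff)
qed

lemma sum_word_state_nth:
  assumes "a \<in> words (max_shift T)"
  shows "(\<Sum>t\<in>T. word_state a t ! 0) = (\<Sum>t\<in>T. a ! (max_shift T + 1 - t))"
  using assms T(3) by (intro sum.cong refl) (auto simp: word_state_def words_def)

text \<open>The source of the transpose: rows of \<open>W\<close> are new states, whereas rows of
  the de Bruijn matrix are old words.\<close>

lemma W_entry_word_state:
  assumes "a \<in> words (max_shift T)"
  shows "W_entry T (word_state b) (word_state a) = de_bruijn_entry T a b"
  using assms inj_word_state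
  by (simp add: W_entry_def de_bruijn_entry_def state_shift_word_state sum_word_state_nth inj_eq)

lemma W_entry_nonzero: "W_entry T v u \<noteq> 0 \<Longrightarrow> \<exists>\<epsilon>. v = state_shift T \<epsilon> u"
  unfolding W_entry_def by (auto split: if_splits)

section \<open>The indices that survive the deletion of zero rows\<close>

abbreviation word_indices :: "state option set" where
  "word_indices \<equiv> insert None (Some ` word_state ` words (max_shift T))"

text \<open>Every word has a predecessor that is again a word, and the entry between them is a sign.
  The final row keeps its diagonal entry 2.\<close>

lemma word_index_not_zero_row:
  assumes "word_indices \<subseteq> K" "i \<in> word_indices"
  shows "\<not> zero_row (expanded_entry T :: _ \<Rightarrow> _ \<Rightarrow> 'a::{ring_1, ring_char_0}) K i"
proof (cases i)
  case None
  then show ?thesis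
    using assms(1) by (auto simp: zero_row_def intro: bexI[where x = None])
next
  case (Some v)
  then obtain b where b: "b \<in> words (max_shift T)" "v = word_state b"
    using assms(2) by auto
  \<comment> \<open>The leading 0 is an arbitrary choice, as the shift discards it.\<close>
  define a where "a = 0 # butlast b"
  have "b \<noteq> []" and a: "a \<in> words (max_shift T)"
    using b(1) max_shift_pos by (auto simp: words_def a_def)
  then have shift: "b = shift (last b) a"
    by (simp add: shift_def a_def)
  have "(W_entry T v (word_state a) :: 'a) = de_bruijn_entry T a (shift (last b) a)"
    unfolding b(2) by (subst W_entry_word_state[OF a]) (simp flip: shift)
  also have "\<dots> \<noteq> 0"
    unfolding de_bruijn_entry_shift by (simp add: sgn_bit_def)
  finally have "expanded_entry T i (Some (word_state a)) \<noteq> (0 :: 'a)"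
    by (simp add: Some)
  moreover have "Some (word_state a) \<in> K"
    using assms(1) a by auto
  ultimately show ?thesis
    unfolding zero_row_def by blast
qed

text \<open>The lower bound is an invariant: while all word indices are present none of them has a
  zero row, so each deletion hits another index.\<close>

lemma delete_zero_rows_bounds:
  assumes "(delete_zero_row (expanded_entry T :: _ \<Rightarrow> _ \<Rightarrow> 'a::{ring_1, ring_char_0}))\<^sup>*\<^sup>*
    (expanded_indices T) K"
  shows "word_indices \<subseteq> K \<and> K \<subseteq> expanded_indices T"
  using assms
proof (induction rule: rtranclp_induct)
  case base
  then show ?case
    using word_state_in_states by (auto simp: expanded_indices_def)
next
  case (step K L)
  then show ?case
    using word_index_not_zero_row[of K, where 'a = 'a] by (auto simp: delete_zero_row_def)
qed

text \<open>Without zero rows every remaining state has a predecessor among the remaining states.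
  Going back \<open>n\<close> times exhibits \<open>v\<close> as the result of shifting the letters
  of \<open>w\<close> into some state \<open>u\<close>.\<close>

lemma ancestors_in_index_set:
  assumes K: "K \<subseteq> expanded_indices T"
    and no_zero: "\<And>i. \<not> zero_row (expanded_entry T :: _ \<Rightarrow> _ \<Rightarrow> 'a::ring_1) K i"
    and "Some v \<in> K"
  shows "\<exists>u\<in>states T. \<exists>w. length w = n \<and> v = (\<lambda>t\<in>T. drop n (u t @ w))"
  using \<open>Some v \<in> K\<close>
proof (induction n arbitrary: v)
  case 0
  then have "v \<in> states T"
    using K by (auto simp: expanded_indices_def)
  then show ?case
    by (intro bexI[of _ v] exI[of _ "[]"]) (auto simp: states_def PiE_def extensional_def fun_eq_iff)
next
  case (Suc n)
  obtain j where j: "j \<in> K" "expanded_entry T (Some v) j \<noteq> (0 :: 'a)"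
    using no_zero[of "Some v"] Suc.prems by (auto simp: zero_row_def)
  \<comment> \<open>The column \<open>None\<close> vanishes in every row \<open>Some v\<close>, so
    the nonzero entry sits in a state column.\<close>
  then obtain v' where v': "Some v' \<in> K" "W_entry T v v' \<noteq> (0 :: 'a)"
    by (cases j) auto
  obtain \<epsilon> where \<epsilon>: "v = state_shift T \<epsilon> v'"
    using W_entry_nonzero[OF v'(2)] by blast
  obtain u w where u: "u \<in> states T" and w: "length w = n" "v' = (\<lambda>t\<in>T. drop n (u t @ w))"
    using Suc.IH[OF v'(1)] by blast
  have "tl (drop n (u t @ w)) @ [\<epsilon>] = drop (Suc n) (u t @ w @ [\<epsilon>])" if "t \<in> T" for t
  proof -
    have "length (u t) = t - 1" "1 < t"
      using u that T(3) by (auto simp: states_def words_def)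
    then have "Suc n \<le> length (u t @ w)"
      using w(1) by simp
    then have "drop (Suc n) ((u t @ w) @ [\<epsilon>]) = drop (Suc n) (u t @ w) @ [\<epsilon>]"
      unfolding drop_append[of _ "u t @ w"] by simp
    then show ?thesis
      by (simp only: append_assoc drop_Suc tl_drop)
  qed
  then have "v = (\<lambda>t\<in>T. drop (Suc n) (u t @ w @ [\<epsilon>]))"
    by (auto simp: \<epsilon> w(2) state_shift_def shift_def fun_eq_iff)
  then show ?case
    using u w(1) by (intro bexI[of _ u] exI[of _ "w @ [\<epsilon>]"]) auto
qed

text \<open>After \<open>max_shift T\<close> shifts nothing of the initial state is left in any
  component, so a surviving state comes from a word. In particular the order of the deletions does
  not affect the result.\<close>

lemma remaining_indices:
  assumes "(delete_zero_row (expanded_entry T :: _ \<Rightarrow> _ \<Rightarrow> 'a::{ring_1, ring_char_0}))\<^sup>*\<^sup>*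
      (expanded_indices T) K"
    and no_zero: "\<And>i. \<not> zero_row (expanded_entry T :: _ \<Rightarrow> _ \<Rightarrow> 'a) K i"
  shows "K = word_indices"
proof
  have K: "word_indices \<subseteq> K" "K \<subseteq> expanded_indices T"
    using delete_zero_rows_bounds[OF assms(1)] by auto
  show "word_indices \<subseteq> K" by fact
  show "K \<subseteq> word_indices"
  proof
    fix i assume "i \<in> K"
    show "i \<in> word_indices"
    proof (cases i)
      case (Some v)
      then obtain u w where u: "u \<in> states T" and w: "length w = max_shift T"
        and v: "v = (\<lambda>t\<in>T. drop (max_shift T) (u t @ w))"
        using ancestors_in_index_set[OF K(2) no_zero, of v "max_shift T"] \<open>i \<in> K\<close> by blast
      \<comment> \<open>All \<open>t - 1\<close> letters of \<open>u t\<close> are dropped, which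
        leaves \<open>max_shift T - (t - 1)\<close> letters to drop from \<open>w\<close>.\<close>
      have "drop (max_shift T) (u t @ w) = drop (max_shift T + 1 - t) w" if "t \<in> T" for t
      proof -
        have "length (u t) = t - 1" "1 < t"
          using u that T(3) by (auto simp: states_def words_def)
        then show ?thesis
          using max_shift_ge[OF that] by simp
      qed
      then have "v = word_state w"
        by (auto simp: v word_state_def fun_eq_iff)
      then show ?thesis
        using Some w by (auto simp: words_def)
    qed simp
  qed
qed

section \<open>The block form of the rules matrix and the conclusion\<close>

lemma rules_matrix_similar_block:
  fixes B R :: "'a::{comm_ring_1, ring_char_0} mat"
  assumes "signed_de_bruijn_matrix T B" "rules_matrix T R"
  shows "\<exists>C \<in> carrier_mat 1 (2 ^ max_shift T). similar_mat R
    (four_block_mat (transpose_mat B) (0\<^sub>m (2 ^ max_shift T) 1) C (mat 1 1 (\<lambda>_. 2)))"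
proof -
  obtain xs where xs: "distinct xs" "set xs = words (max_shift T)"
    and B: "B = indexed_mat xs (de_bruijn_entry T)"
    using assms by (auto simp: signed_de_bruijn_matrix_def mat_indexed_by_def)
  have len: "length xs = 2 ^ max_shift T"
    using xs by (rule length_enumeration_words)
  obtain K ys where K: "(delete_zero_row (expanded_entry T :: _ \<Rightarrow> _ \<Rightarrow> 'a))\<^sup>*\<^sup>* (expanded_indices T) K"
      "\<And>i. \<not> zero_row (expanded_entry T :: _ \<Rightarrow> _ \<Rightarrow> 'a) K i"
    and ys: "distinct ys" "set ys = K" and R: "R = indexed_mat ys (expanded_entry T)"
    using assms(2) by (auto simp: rules_matrix_def mat_indexed_by_def)
  \<comment> \<open>The words in the order used by \<open>B\<close>, followed by the adjoined index,
    so that the blocks appear literally.\<close>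
  define zs where "zs = map (\<lambda>a. Some (word_state a)) xs @ [None]"
  have zs: "distinct zs" "set zs = K"
    using xs inj_word_state remaining_indices[OF K]
    by (auto simp: zs_def distinct_map inj_on_def inj_def)
  define C :: "'a mat" where
    "C = mat 1 (length xs) (\<lambda>(_, j). expanded_entry T None (Some (word_state (xs ! j))))"
  have "indexed_mat zs (expanded_entry T) =
    four_block_mat (transpose_mat B) (0\<^sub>m (length xs) 1) C (mat 1 1 (\<lambda>_. 2))"
  proof (rule eq_matI)
    fix i j
    assume "i < dim_row (four_block_mat (transpose_mat B) (0\<^sub>m (length xs) 1) C (mat 1 1 (\<lambda>_. 2)))"
      "j < dim_col (four_block_mat (transpose_mat B) (0\<^sub>m (length xs) 1) C (mat 1 1 (\<lambda>_. 2)))"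
    then have ij: "i < Suc (length xs)" "j < Suc (length xs)"
      by (simp_all add: B indexed_mat_def)
    have "W_entry T (word_state (xs ! i)) (word_state (xs ! j))
        = (de_bruijn_entry T (xs ! j) (xs ! i) :: 'a)" if "j < length xs"
      using nth_mem[OF that] unfolding xs(2) by (rule W_entry_word_state)
    then show "indexed_mat zs (expanded_entry T) $$ (i, j) =
      four_block_mat (transpose_mat B) (0\<^sub>m (length xs) 1) C (mat 1 1 (\<lambda>_. 2)) $$ (i, j)"
      using ij by (auto simp: indexed_mat_def zs_def nth_append B C_def)
  qed (simp_all add: indexed_mat_def zs_def B)
  moreover have "similar_mat R (indexed_mat zs (expanded_entry T))"
    unfolding R using ys zs by (intro similar_indexed_mat) auto
  moreover have "C \<in> carrier_mat 1 (2 ^ max_shift T)"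
    by (simp add: C_def len)
  ultimately show ?thesis
    by (auto simp: len)
qed

end

theorem mainTheorem6:
  fixes T :: "nat set" and B R :: "rat mat"
  assumes "finite T" and "T \<noteq> {}" and "\<forall>t\<in>T. 1 < t"
    and "signed_de_bruijn_matrix T B"
    and "rules_matrix T R"
  shows "invertible_mat R \<and>
    similar_mat R
      (four_block_mat (transpose_mat B) (0\<^sub>m (2 ^ max_shift T) 1)
                      (0\<^sub>m 1 (2 ^ max_shift T)) (mat 1 1 (\<lambda>_. 2))) \<and>
    diagonalizable (map_mat of_rat R :: complex mat)"
proof -
  define n :: nat where "n = 2 ^ max_shift T"
  define A where "A = transpose_mat B"
  define D :: "rat mat" where "D = mat 1 1 (\<lambda>_. 2)"
  have B: "B * transpose_mat B = 2 \<cdot>\<^sub>m 1\<^sub>m n"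
    unfolding n_def using assms(1-4) by (rule signed_de_bruijn_mult_transpose)
  then have AA: "transpose_mat A * A = 2 \<cdot>\<^sub>m 1\<^sub>m n"
    by (simp add: A_def)
  have A: "A \<in> carrier_mat n n"
    using signed_de_bruijn_carrier[OF assms(4)] by (simp add: A_def n_def)
  have D: "D \<in> carrier_mat 1 1"
    by (simp add: D_def)
  obtain C where C: "C \<in> carrier_mat 1 n" and RC: "similar_mat R (four_block_mat A (0\<^sub>m n 1) C D)"
    using rules_matrix_similar_block[OF assms] unfolding n_def A_def D_def by blast
  \<comment> \<open>The eigenvalue 2 is excluded because its square 4 differs from the scaling
    factor 2.\<close>
  have "det (2 \<cdot>\<^sub>m 1\<^sub>m n - A) \<noteq> 0"
    using A AA by (rule no_eigenvalue_conformal) simp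
  moreover have E: "2 \<cdot>\<^sub>m 1\<^sub>m n - A \<in> carrier_mat n n"
    using A by auto
  ultimately obtain E' where E': "E' \<in> carrier_mat n n" "E' * (2 \<cdot>\<^sub>m 1\<^sub>m n - A) = 1\<^sub>m n"
    using det_nonzero_obtains_inverse by metis
  \<comment> \<open>As \<open>D\<close> acts as the scalar 2, the Sylvester equation becomes
    \<open>Y * (2 \<cdot>\<^sub>m 1\<^sub>m n - A) = C\<close>, which is solved by the inverse
    \<open>E'\<close>.\<close>
  define Y where "Y = C * E'"
  have Y: "Y \<in> carrier_mat 1 n"
    using C E'(1) by (simp add: Y_def)
  have "Y * (2 \<cdot>\<^sub>m 1\<^sub>m n - A) = C"
    unfolding Y_def using C E' E by (simp add: assoc_mult_mat[of _ 1 n _ n _ n])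
  moreover have "Y * (2 \<cdot>\<^sub>m 1\<^sub>m n - A) = 2 \<cdot>\<^sub>m Y - Y * A"
    using Y A by (subst mult_minus_distrib_mat[of _ 1 n _ n])
      (auto simp: mult_smult_distrib[of _ 1 n _ n])
  moreover have "D * Y = 2 \<cdot>\<^sub>m Y"
    using Y by (intro eq_matI) (auto simp: D_def scalar_prod_def)
  ultimately have "Y * A + C = D * Y"
    using Y A C by (auto intro!: eq_matI)
  then have "similar_mat (four_block_mat A (0\<^sub>m n 1) C D) (four_block_mat A (0\<^sub>m n 1) (0\<^sub>m 1 n) D)"
    using A D C Y by (intro similar_mat_four_block_lower)
  with RC have sim: "similar_mat R (four_block_mat A (0\<^sub>m n 1) (0\<^sub>m 1 n) D)"
    by (rule similar_mat_trans)
  have "det (four_block_mat A (0\<^sub>m n 1) (0\<^sub>m 1 n) D) = det A * det D"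
    using A D by (intro det_four_block_mat_upper_right_zero) auto
  moreover have "det A \<noteq> 0"
    using A AA by (rule det_nonzero_conformal) simp
  moreover have "det D = 2"
    by (simp add: D_def det_single)
  ultimately have "det R \<noteq> 0"
    using det_similar[OF sim] by simp
  \<comment> \<open>The size of \<open>R\<close> is read off from the similarity.\<close>
  moreover have "R \<in> carrier_mat (n + 1) (n + 1)"
  proof -
    have "four_block_mat A (0\<^sub>m n 1) (0\<^sub>m 1 n) D \<in> carrier_mat (n + 1) (n + 1)"
      using A D by (rule four_block_carrier_mat)
    moreover obtain P Q where "similar_mat_wit (four_block_mat A (0\<^sub>m n 1) (0\<^sub>m 1 n) D) R P Q"
      using similar_mat_sym[OF sim] by (auto simp: similar_mat_def)
    ultimately show ?thesis
      by (rule similar_mat_witD2(5))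
  qed
  ultimately have inv: "invertible_mat R"
    by (intro invertible_mat_det_nonzero)
  let ?h = "map_mat of_rat :: rat mat \<Rightarrow> complex mat"
  have "diagonalizable (?h A)"
    using A AA by (rule diagonalizable_rat_conformal) simp
  moreover have "diagonalizable (?h D)"
    unfolding diagonalizable_def
    using D by (intro exI[of _ "?h D"]) (auto simp: diagonal_mat_def intro!: similar_mat_refl)
  ultimately have "diagonalizable (four_block_mat (?h A) (0\<^sub>m n 1) (0\<^sub>m 1 n) (?h D))"
    using A D by (intro diagonalizable_four_block) auto
  moreover have "?h (four_block_mat A (0\<^sub>m n 1) (0\<^sub>m 1 n) D)
      = four_block_mat (?h A) (0\<^sub>m n 1) (0\<^sub>m 1 n) (?h D)"
    using A D by (subst map_four_block_mat[of _ n n _ 1 _ 1]) (auto intro!: cong_four_block_mat eq_matI)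
  ultimately have "diagonalizable (?h R)"
    using of_rat_hom.similar_mat_hom[OF sim] diagonalizable_similar by metis
  then show ?thesis
    using inv sim unfolding n_def A_def D_def by blast
qed

end
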